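(* Setup: - Let $G=(V,E)$ and $G'=(V',E')$ be graphs, and let $z\in V'$. - Let $\mathcal G=\langle G,h,g\rangle$ and $\mathcal G'=\langle G',h',g'\rangle$ be winning games. - Let $I\subseteq S\subseteq V$ be such that $(S,I)$ is a predictable pair for some winning strategy of $\mathcal G$. - Assume that for each $v\in I$ there are natural numbers $s_v,a_v,b'_v$ with $g(v)=s_va_v$ and $h'(z)=s_vb'_v$. - Let $\widetilde G$ be the graph with vertex set $V\cup V'\setminus\{z\}$ and edge set $E\cup E(G'\setminus\{z\})\cup\{uw: u\in S,\ w\in N_{G'}(z)\}$. Conclusion: the game $\widetilde{\mathcal G}=\langle\widetilde G,\widetilde h,\widetilde g\rangle$ is winning, where $(\widetilde h(u),\widetilde g(u))$ equals - $(h(u),g(u))$ for $u\in V\setminus S$; - $(h'(u),g'(u))$ for $u\in V'\setminus\{z\}$; - $(h(u)h'(z),\,g(u)g'(z))$ for $u\in S\setminus I$; - $(h(u)b'_u,\,a_ug'(z))$ for $u\in I$.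
   Context: Hat guessing game $\langle G,h,g\rangle$: $G=(V,E)$ is a finite graph and $h,g\colon V\to\mathbb N$. The adversary gives each vertex $v$ a color in $\{0,\dots,h(v)-1\}$. Each vertex sees only its neighbors' colors and names at most $g(v)$ colors, according to a deterministic strategy fixed in advance that depends only on the neighbors' colors. A strategy is winning if for every assignment some vertex names its own color. The game is winning if a winning strategy exists. $N_{G'}(z)$ denotes the neighborhood of $z$ in $G'$. Predictable pair: fix a strategy of the sages in $\langle G,h,g\rangle$ and let $I\subseteq S\subseteq V$. The pair $(S,I)$ is predictable (for this strategy) if there exists an algorithm with the following two properties, holding for every hat assignment on $V$: 1. Using only the hat colors on $S$, it determines a vertex $u\in S$ that guessed his color correctly, provided that at least one vertex of $S$ guessed correctly. 2. If the determined $u$ lies in $I$, it also determines the set $A_u$ of colors named by $u$ under the strategy. *)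

theory Defs
  imports "Graph_Theory.Pair_Digraph" "HOL-Library.FuncSet"
begin

text \<open>
  A finite simple graph is a \<^locale>\<open>pair_graph\<close>: finitely many vertices and an irreflexive
  symmetric set of arcs, so that an undirected edge \<open>uw\<close> is the pair of arcs \<open>(u, w)\<close>, \<open>(w, u)\<close>.
\<close>

definition neighborhood :: "'a pair_pre_digraph \<Rightarrow> 'a \<Rightarrow> 'a set" where
  "neighborhood G v = {w. (v, w) \<in> parcs G}"

definition colorings :: "'a set \<Rightarrow> ('a \<Rightarrow> nat) \<Rightarrow> ('a \<Rightarrow> nat) set" where
  "colorings A h = (\<Pi>\<^sub>E v\<in>A. {..<h v})"

text \<open>
  A strategy \<open>f\<close> assigns to a vertex \<open>v\<close> and a coloring of its neighborhood the set of colors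
  named by \<open>v\<close>. Everything a vertex (or the algorithm in the definition of predictable pairs) may
  use is passed as a restriction of the hat assignment to the visible vertices.
\<close>

definition is_strategy ::
  "'a pair_pre_digraph \<Rightarrow> ('a \<Rightarrow> nat) \<Rightarrow> ('a \<Rightarrow> nat) \<Rightarrow> ('a \<Rightarrow> ('a \<Rightarrow> nat) \<Rightarrow> nat set) \<Rightarrow> bool" where
  "is_strategy G h g f \<longleftrightarrow>
    (\<forall>v\<in>pverts G. \<forall>x\<in>colorings (neighborhood G v) h. f v x \<subseteq> {..<h v} \<and> card (f v x) \<le> g v)"

definition named_colors ::
  "'a pair_pre_digraph \<Rightarrow> ('a \<Rightarrow> ('a \<Rightarrow> nat) \<Rightarrow> nat set) \<Rightarrow> ('a \<Rightarrow> nat) \<Rightarrow> 'a \<Rightarrow> nat set" where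
  "named_colors G f c v = f v (restrict c (neighborhood G v))"

definition guesses_correctly ::
  "'a pair_pre_digraph \<Rightarrow> ('a \<Rightarrow> ('a \<Rightarrow> nat) \<Rightarrow> nat set) \<Rightarrow> ('a \<Rightarrow> nat) \<Rightarrow> 'a \<Rightarrow> bool" where
  "guesses_correctly G f c v \<longleftrightarrow> c v \<in> named_colors G f c v"

definition winning_strategy ::
  "'a pair_pre_digraph \<Rightarrow> ('a \<Rightarrow> nat) \<Rightarrow> ('a \<Rightarrow> nat) \<Rightarrow> ('a \<Rightarrow> ('a \<Rightarrow> nat) \<Rightarrow> nat set) \<Rightarrow> bool" where
  "winning_strategy G h g f \<longleftrightarrow> is_strategy G h g f \<and>
    (\<forall>c\<in>colorings (pverts G) h. \<exists>v\<in>pverts G. guesses_correctly G f c v)"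

definition winning_game ::
  "'a pair_pre_digraph \<Rightarrow> ('a \<Rightarrow> nat) \<Rightarrow> ('a \<Rightarrow> nat) \<Rightarrow> bool" where
  "winning_game G h g \<longleftrightarrow> (\<exists>f. winning_strategy G h g f)"

text \<open>
  Predictability of \<open>(S, I)\<close>, for \<open>I \<subseteq> S \<subseteq> V\<close>: \<open>alg\<close> determines the vertex and \<open>names\<close> the set
  of colors it names. Nothing is required of either of them on hat assignments for which no vertex
  of \<open>S\<close> guesses correctly.
\<close>

definition predictable ::
  "'a pair_pre_digraph \<Rightarrow> ('a \<Rightarrow> nat) \<Rightarrow> ('a \<Rightarrow> ('a \<Rightarrow> nat) \<Rightarrow> nat set) \<Rightarrow> 'a set \<Rightarrow> 'a set \<Rightarrow> bool" where
  "predictable G h f S I \<longleftrightarrow>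
    (\<exists>(alg :: ('a \<Rightarrow> nat) \<Rightarrow> 'a) (names :: ('a \<Rightarrow> nat) \<Rightarrow> nat set).
      \<forall>c\<in>colorings (pverts G) h. (\<exists>v\<in>S. guesses_correctly G f c v) \<longrightarrow>
        (let u = alg (restrict c S) in
          u \<in> S \<and> guesses_correctly G f c u \<and>
          (u \<in> I \<longrightarrow> names (restrict c S) = named_colors G f c u)))"

definition substitute_vertex ::
  "'a pair_pre_digraph \<Rightarrow> 'a set \<Rightarrow> 'a pair_pre_digraph \<Rightarrow> 'a \<Rightarrow> 'a pair_pre_digraph" where
  "substitute_vertex G S G' z =
    \<lparr> pverts = pverts G \<union> (pverts G' - {z}),
      parcs = parcs G \<union> {(u, w) \<in> parcs G'. u \<noteq> z \<and> w \<noteq> z}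
        \<union> S \<times> neighborhood G' z \<union> neighborhood G' z \<times> S \<rparr>"

lemma pair_graph_substitute_vertex:
  assumes G: "pair_graph G" and G': "pair_graph G'" and S: "S \<subseteq> pverts G"
    and disj: "pverts G \<inter> (pverts G' - {z}) = {}"
  shows "pair_graph (substitute_vertex G S G' z)"
proof -
  interpret G: pair_graph G by (rule G)
  interpret G': pair_graph G' by (rule G')
  have sym: "(b, a) \<in> parcs G" if "(a, b) \<in> parcs G" for a b
    using G.pair_sym_arcs that by (auto simp: symmetric_def dest: symD)
  have sym': "(b, a) \<in> parcs G'" if "(a, b) \<in> parcs G'" for a b
    using G'.pair_sym_arcs that by (auto simp: symmetric_def dest: symD)
  have loop: "(a, a) \<notin> parcs G" "(a, a) \<notin> parcs G'" for a
    using G.pair_no_loops G'.pair_no_loops by fastforce+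
  have N: "neighborhood G' z \<subseteq> pverts G' - {z}"
    using G'.in_arcsD2 loop by (auto simp: neighborhood_def)
  have finN: "finite (neighborhood G' z)" and finS: "finite S"
    using N S G.pair_finite_verts G'.pair_finite_verts by (auto intro: finite_subset)
  have finA: "finite {(u, w) \<in> parcs G'. u \<noteq> z \<and> w \<noteq> z}"
    by (rule finite_subset[OF _ G'.pair_finite_arcs]) auto
  show ?thesis
  proof unfold_locales
    fix e assume e: "e \<in> parcs (substitute_vertex G S G' z)"
    show "fst e \<in> pverts (substitute_vertex G S G' z)" "snd e \<in> pverts (substitute_vertex G S G' z)"
      using e N S by (auto simp: substitute_vertex_def dest: G.in_arcsD1 G.in_arcsD2
          G'.in_arcsD1 G'.in_arcsD2)
    have "S \<inter> neighborhood G' z = {}"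
      using N S disj by blast
    then show "fst e \<noteq> snd e"
      using e loop by (cases e) (auto simp: substitute_vertex_def)
  next
    show "finite (pverts (substitute_vertex G S G' z))" "finite (parcs (substitute_vertex G S G' z))"
      using G.pair_finite_verts G'.pair_finite_verts G.pair_finite_arcs finA finN finS
      by (auto simp: substitute_vertex_def)
  next
    show "symmetric (substitute_vertex G S G' z)"
      using sym sym' by (auto simp: symmetric_def substitute_vertex_def intro!: symI)
  qed
qed

end

theory Submission
  imports Defs
begin

text \<open>
  The hat of a vertex \<open>u \<in> S\<close> encodes a pair: a color of \<open>u\<close> in the game on \<open>G\<close>, and a residue modulo
  \<open>b u\<close>. The vertices of \<open>G\<close> play their winning strategy on the first components. If none of those
  outside \<open>S\<close> succeeds, everybody who sees \<open>S\<close> can compute a vertex \<open>u \<in> S\<close> whose first component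
  lies in its set \<open>A\<close> of \<open>s u * a u\<close> named colors. That vertex impersonates \<open>z\<close> in the game on
  \<open>G'\<close>: the rank of its first component in \<open>A\<close>, taken modulo \<open>s u\<close>, together with its residue is one
  of the \<open>s u * b u = h' z\<close> colors of \<open>z\<close>. Each color of \<open>z\<close> arises from at most \<open>a u\<close> elements of
  \<open>A\<close>, so naming all hats of \<open>u\<close> compatible with the guess of \<open>z\<close> takes at most \<open>a u * g' z\<close> colors.
  Vertices of \<open>S - I\<close> are the case \<open>s u = 1\<close>, where the rank is irrelevant and \<open>A\<close> need not be known.
\<close>

section \<open>Ranks in finite sets and the merged color\<close>

definition rank_in :: "nat set \<Rightarrow> nat \<Rightarrow> nat" where
  "rank_in A k = card {j \<in> A. j < k}"

lemma rank_in_less: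
  assumes "finite A" "k \<in> A"
  shows "rank_in A k < card A"
  unfolding rank_in_def using assms by (intro psubset_card_mono) auto

lemma inj_on_rank_in:
  assumes "finite A"
  shows "inj_on (rank_in A) A"
proof -
  have less: "rank_in A k < rank_in A l" if "k < l" "k \<in> A" for k l
    unfolding rank_in_def using assms that by (intro psubset_card_mono) auto
  show ?thesis
    by (rule linorder_inj_onI') (use less in fastforce)
qed

text \<open>A two-digit number to base \<open>b\<close>: the leading digit is the rank of
  \<open>k div b\<close> reduced modulo \<open>s\<close>, the last one is the residue of
  \<open>k\<close>. The hat \<open>k\<close> itself is read as the pair
  \<open>(k div b, k mod b)\<close>.\<close>

definition merged_color :: "nat \<Rightarrow> nat \<Rightarrow> nat set \<Rightarrow> nat \<Rightarrow> nat" where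
  "merged_color s b A k = (rank_in A (k div b) mod s) * b + k mod b"

lemma merged_color_less:
  assumes "0 < s" "0 < b"
  shows "merged_color s b A k < s * b"
proof -
  have "merged_color s b A k < (rank_in A (k div b) mod s + 1) * b"
    using assms by (simp add: merged_color_def)
  also have "\<dots> \<le> s * b"
    using assms by (intro mult_right_mono) (auto simp: Suc_leI)
  finally show ?thesis .
qed

lemma merged_color_one [simp]: "merged_color (Suc 0) b A k = k mod b"
  by (simp add: merged_color_def)

text \<open>\<open>merged_color\<close> forgets only the quotient of the rank by \<open>s\<close>;
  restoring it recovers rank and residue, hence \<open>k\<close>. As ranks lie below
  \<open>s * a\<close>, that quotient takes at most \<open>a\<close> values.\<close>

lemma card_merged_color_vimage_le:
  assumes A: "A \<subseteq> {..<n}" "card A \<le> s * a" and Z: "finite Z" "card Z \<le> t"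
  shows "card {k. k < n * b \<and> k div b \<in> A \<and> merged_color s b A k \<in> Z} \<le> a * t"
    (is "card ?K \<le> _")
proof -
  have finA: "finite A"
    using A by (auto intro: finite_subset)
  define F where "F k = (rank_in A (k div b) div s, merged_color s b A k)" for k
  have "inj_on F ?K"
  proof (rule inj_onI)
    fix k l assume k: "k \<in> ?K" and l: "l \<in> ?K" and eq: "F k = F l"
    have b: "0 < b"
      using k by (auto intro: gr0I)
    have m: "merged_color s b A k = merged_color s b A l"
      using eq by (simp add: F_def)
    then have "merged_color s b A k mod b = merged_color s b A l mod b"
      and "merged_color s b A k div b = merged_color s b A l div b"
      by simp_all
    then have "k mod b = l mod b" and "rank_in A (k div b) mod s = rank_in A (l div b) mod s"
      using b by (simp_all add: merged_color_def)
    moreover have "rank_in A (k div b) div s = rank_in A (l div b) div s"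
      using eq by (simp add: F_def)
    ultimately have "k mod b = l mod b" "rank_in A (k div b) = rank_in A (l div b)"
      by (metis div_mult_mod_eq)+
    moreover from this have "k div b = l div b"
      using inj_on_rank_in[OF finA] k l by (auto dest: inj_onD)
    ultimately show "k = l"
      by (metis div_mult_mod_eq)
  qed
  moreover have "F ` ?K \<subseteq> {..<a} \<times> Z"
  proof -
    have "rank_in A (k div b) div s < a" if "k \<in> ?K" for k
      using rank_in_less[OF finA, of "k div b"] that A(2)
      by (intro less_mult_imp_div_less) (auto simp: mult.commute)
    then show ?thesis
      by (auto simp: F_def)
  qed
  ultimately have "card ?K \<le> card ({..<a} \<times> Z)"
    using Z by (intro card_inj_on_le[of F]) auto
  also have "\<dots> \<le> a * t"
    using Z by (simp add: card_cartesian_product)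
  finally show ?thesis .
qed

section \<open>Legal colorings and the composite game with its strategy\<close>

lemma restrict_in_colorings:
  assumes "\<And>v. v \<in> N \<Longrightarrow> x v < h v"
  shows "restrict x N \<in> colorings N h"
  using assms by (auto simp: colorings_def)

lemma coloring_less:
  assumes "x \<in> colorings N h" "v \<in> N"
  shows "x v < h v"
  using assms by (auto simp: colorings_def)

text \<open>\<open>I\<close> is absent, so that \<open>S - I\<close> needs no separate treatment:
  the factorizations cover all of \<open>S\<close>, and \<open>names\<close> is trusted only where
  \<open>s\<close> differs from 1.\<close>

locale vertex_substitution =
  fixes G G' :: "'a pair_pre_digraph"
    and h g h' g' :: "'a \<Rightarrow> nat"
    and z :: 'a
    and S :: "'a set"
    and s a b :: "'a \<Rightarrow> nat"
    and f f' :: "'a \<Rightarrow> ('a \<Rightarrow> nat) \<Rightarrow> nat set"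
    and alg :: "('a \<Rightarrow> nat) \<Rightarrow> 'a"
    and names :: "('a \<Rightarrow> nat) \<Rightarrow> nat set"
  assumes graph: "pair_graph G" "pair_graph G'"
    and z: "z \<in> pverts G'"
    and disj: "pverts G \<inter> (pverts G' - {z}) = {}"
    and S: "S \<subseteq> pverts G"
    and f: "winning_strategy G h g f"
    and f': "winning_strategy G' h' g' f'"
    and alg: "\<And>c. c \<in> colorings (pverts G) h \<Longrightarrow> \<exists>v\<in>S. guesses_correctly G f c v \<Longrightarrow>
      alg (restrict c S) \<in> S \<and> guesses_correctly G f c (alg (restrict c S))"
    and names: "\<And>c. c \<in> colorings (pverts G) h \<Longrightarrow> \<exists>v\<in>S. guesses_correctly G f c v \<Longrightarrow>
      s (alg (restrict c S)) \<noteq> 1 \<Longrightarrow>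
      names (restrict c S) = named_colors G f c (alg (restrict c S))"
    and g_eq: "\<And>v. v \<in> S \<Longrightarrow> g v = s v * a v"
    and h'_eq: "\<And>v. v \<in> S \<Longrightarrow> h' z = s v * b v"
begin

abbreviation "GS \<equiv> substitute_vertex G S G' z"

definition hS :: "'a \<Rightarrow> nat" where
  "hS u = (if u \<in> S then h u * b u else if u \<in> pverts G then h u else h' u)"

definition gS :: "'a \<Rightarrow> nat" where
  "gS u = (if u \<in> S then a u * g' z else if u \<in> pverts G then g u else g' u)"

definition proj :: "('a \<Rightarrow> nat) \<Rightarrow> 'a \<Rightarrow> nat" where
  "proj x v = (if v \<in> S then x v div b v else x v)"

text \<open>Meaningful only if some vertex of \<open>S\<close> guesses \<open>proj x\<close> correctly.\<close>

definition z_color :: "('a \<Rightarrow> nat) \<Rightarrow> nat" where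
  "z_color x = (let y = restrict (proj x) S; u = alg y in
     if u \<in> S then merged_color (s u) (b u) (names y) (x u) else 0)"

text \<open>
  The guard \<open>h' z = 0\<close> is there because no value of \<open>z_color\<close> is a legal color in that case, so that
  \<open>f'\<close> is not known to name few colors.
\<close>

definition fS :: "'a \<Rightarrow> ('a \<Rightarrow> nat) \<Rightarrow> nat set" where
  "fS v x =
    (if v \<in> S then
       (let A = named_colors G f (proj x) v in
        {k. k < h v * b v \<and> k div b v \<in> A \<and>
            merged_color (s v) (b v) A k \<in> named_colors G' f' x z})
     else if v \<in> pverts G then named_colors G f (proj x) v
     else if h' z = 0 then {}
     else named_colors G' f' (x(z := z_color x)) v)"

text \<open>Valid even if \<open>alg\<close> errs: for \<open>u\<close> in \<open>S\<close> the
  product \<open>s u * b u = h' z\<close> is positive, so both factors are; otherwise the default 0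
  is legal.\<close>

lemma z_color_less: "h' z \<noteq> 0 \<Longrightarrow> z_color x < h' z"
  using h'_eq by (auto simp: z_color_def Let_def intro!: merged_color_less)

section \<open>What the vertices of the composite graph see\<close>

lemma z_notin_neighborhood: "z \<notin> neighborhood G' z"
proof -
  interpret G': pair_graph G' by (rule graph)
  show ?thesis
    using G'.pair_no_loops by (fastforce simp: neighborhood_def)
qed

lemma neighborhood_sym: "z \<in> neighborhood G' w \<Longrightarrow> w \<in> neighborhood G' z"
proof -
  interpret G': pair_graph G' by (rule graph)
  show "z \<in> neighborhood G' w \<Longrightarrow> w \<in> neighborhood G' z"
    using G'.pair_sym_arcs by (auto simp: neighborhood_def symmetric_def dest: symD)
qed

lemma neighborhood_subset:
  "neighborhood G v \<subseteq> pverts G" "neighborhood G' v \<subseteq> pverts G'"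
proof -
  interpret G: pair_graph G by (rule graph)
  interpret G': pair_graph G' by (rule graph)
  show "neighborhood G v \<subseteq> pverts G" "neighborhood G' v \<subseteq> pverts G'"
    by (auto simp: neighborhood_def dest: G.in_arcsD2 G'.in_arcsD2)
qed

text \<open>The visibility behind the strategy: vertices of \<open>S\<close> can evaluate the guess
  of \<open>z\<close>, and neighbors of \<open>z\<close> can compute \<open>z_color\<close>.\<close>

lemma neighborhood_GS:
  shows "neighborhood G v \<subseteq> neighborhood GS v"
    and "v \<in> S \<Longrightarrow> neighborhood G' z \<subseteq> neighborhood GS v"
    and "v \<noteq> z \<Longrightarrow> neighborhood G' v - {z} \<subseteq> neighborhood GS v"
    and "z \<in> neighborhood G' v \<Longrightarrow> S \<subseteq> neighborhood GS v"
  using neighborhood_sym[of v] by (auto simp: neighborhood_def substitute_vertex_def)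

section \<open>Legality and locality of the composite strategy\<close>

lemma hS_outside: "v \<in> pverts G' \<Longrightarrow> v \<noteq> z \<Longrightarrow> hS v = h' v"
  using disj S by (auto simp: hS_def)

lemma proj_less:
  assumes "v \<in> pverts G" "x v < hS v"
  shows "proj x v < h v"
  using assms by (auto simp: proj_def hS_def less_mult_imp_div_less split: if_splits)

lemma named_colors_G:
  assumes "v \<in> pverts G" "\<And>w. w \<in> neighborhood G v \<Longrightarrow> x w < hS w"
  shows "named_colors G f (proj x) v \<subseteq> {..<h v}" "card (named_colors G f (proj x) v) \<le> g v"
proof -
  have "restrict (proj x) (neighborhood G v) \<in> colorings (neighborhood G v) h"
    using assms neighborhood_subset(1) by (intro restrict_in_colorings proj_less) auto
  then show "named_colors G f (proj x) v \<subseteq> {..<h v}" "card (named_colors G f (proj x) v) \<le> g v"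
    using f assms(1) by (auto simp: winning_strategy_def is_strategy_def named_colors_def)
qed

lemma named_colors_G':
  assumes "v \<in> pverts G'" "\<And>w. w \<in> neighborhood G' v \<Longrightarrow> x w < h' w"
  shows "named_colors G' f' x v \<subseteq> {..<h' v}" "card (named_colors G' f' x v) \<le> g' v"
  using f' assms restrict_in_colorings[of "neighborhood G' v" x h']
  by (auto simp: winning_strategy_def is_strategy_def named_colors_def)

lemma is_strategy_fS: "is_strategy GS hS gS fS"
  unfolding is_strategy_def
proof (intro ballI)
  fix v x assume v: "v \<in> pverts GS" and x: "x \<in> colorings (neighborhood GS v) hS"
  have x_less: "x w < hS w" if "w \<in> neighborhood GS v" for w
    using coloring_less[OF x that] .
  consider "v \<in> S" | "v \<in> pverts G" "v \<notin> S" | "v \<in> pverts G'" "v \<noteq> z" "v \<notin> pverts G" "v \<notin> S"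
    using v S by (auto simp: substitute_vertex_def)
  then show "fS v x \<subseteq> {..<hS v} \<and> card (fS v x) \<le> gS v"
  proof cases
    case 1
    then have vG: "v \<in> pverts G"
      using S by auto
    have A: "named_colors G f (proj x) v \<subseteq> {..<h v}" "card (named_colors G f (proj x) v) \<le> g v"
      using named_colors_G[OF vG] x_less neighborhood_GS(1) by blast+
    have "x w < h' w" if "w \<in> neighborhood G' z" for w
      using x_less neighborhood_GS(2)[OF 1] hS_outside neighborhood_subset(2)
        z_notin_neighborhood that by (metis subsetD)
    then have Z: "named_colors G' f' x z \<subseteq> {..<h' z}" "card (named_colors G' f' x z) \<le> g' z"
      using named_colors_G'[OF z] by blast+
    have "finite (named_colors G' f' x z)"
      using Z(1) by (auto intro: finite_subset)
    then have "card (fS v x) \<le> a v * g' z"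
      using card_merged_color_vimage_le[OF A(1), of "s v" "a v" "named_colors G' f' x z" "g' z" "b v"]
        A(2) Z(2) g_eq[OF 1] 1 by (simp add: fS_def Let_def)
    then show ?thesis
      using 1 by (auto simp: fS_def hS_def gS_def Let_def)
  next
    case 2
    then show ?thesis
      using named_colors_G[of v x] x_less neighborhood_GS(1) by (auto simp: fS_def hS_def gS_def)
  next
    case 3
    have "(x(z := z_color x)) w < h' w" if "h' z \<noteq> 0" "w \<in> neighborhood G' v" for w
    proof (cases "w = z")
      case True
      then show ?thesis using z_color_less that by simp
    next
      case False
      then have "w \<in> neighborhood GS v" "w \<in> pverts G'"
        using neighborhood_GS(3)[OF 3(2)] neighborhood_subset(2) that by auto
      then show ?thesis using x_less hS_outside False by fastforce
    qed
    then show ?thesis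
      using named_colors_G'[OF 3(1), of "x(z := z_color x)"] 3
      by (auto simp: fS_def hS_def gS_def)
  qed
qed

text \<open>\<open>alg\<close> and \<open>names\<close> read only the hats on \<open>S\<close>, and
  the guard \<open>u \<in> S\<close> in \<open>z_color\<close> ensures that \<open>x u\<close> is
  such a hat too.\<close>

lemma z_color_restrict: "S \<subseteq> N \<Longrightarrow> z_color (restrict c N) = z_color c"
proof -
  assume "S \<subseteq> N"
  then have "restrict (proj (restrict c N)) S = restrict (proj c) S"
    by (auto simp: proj_def restrict_def fun_eq_iff)
  then show ?thesis
    using \<open>S \<subseteq> N\<close> by (auto simp: z_color_def Let_def)
qed

lemma named_colors_restrict:
  assumes "\<And>w. w \<in> neighborhood H v \<Longrightarrow> x w = y w"
  shows "named_colors H k x v = named_colors H k y v"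
  unfolding named_colors_def using assms by (metis restrict_ext)

lemma named_colors_fS_G:
  "named_colors G f (proj (restrict c (neighborhood GS v))) v = named_colors G f (proj c) v"
  using neighborhood_GS(1) by (intro named_colors_restrict) (auto simp: proj_def)

text \<open>The color substituted at \<open>z\<close> matters only if \<open>v\<close> is a neighbor
  of \<open>z\<close>; then \<open>v\<close> sees all of \<open>S\<close> and obtains the same
  value.\<close>

lemma named_colors_fS_G':
  assumes "v \<noteq> z"
  shows "named_colors G' f' ((restrict c (neighborhood GS v))(z := z_color (restrict c (neighborhood GS v)))) v
    = named_colors G' f' (c(z := z_color c)) v"
  using neighborhood_GS(3)[OF assms] neighborhood_GS(4)[THEN z_color_restrict]
  by (intro named_colors_restrict) auto

section \<open>Every coloring of the composite graph is guessed\<close>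

lemma fS_wins:
  assumes c: "c \<in> colorings (pverts GS) hS"
  shows "\<exists>v\<in>pverts GS. guesses_correctly GS fS c v"
proof -
  have c_less: "c v < hS v" if "v \<in> pverts GS" for v
    using coloring_less[OF c that] .
  have sub: "pverts G \<subseteq> pverts GS" "pverts G' - {z} \<subseteq> pverts GS"
    by (auto simp: substitute_vertex_def)
  define p where "p = restrict (proj c) (pverts G)"
  have p: "p \<in> colorings (pverts G) h"
    unfolding p_def using c_less sub proj_less by (intro restrict_in_colorings) auto
  have p_S: "restrict p S = restrict (proj c) S"
    using S by (auto simp: p_def restrict_def fun_eq_iff)
  have named_p: "named_colors G f p v = named_colors G f (proj c) v" for v
    using neighborhood_subset(1) by (intro named_colors_restrict) (auto simp: p_def)
  obtain v where v: "v \<in> pverts G" "guesses_correctly G f p v"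
    using f p by (auto simp: winning_strategy_def)
  show ?thesis
  proof (cases "v \<in> S")
    case False
    then have "guesses_correctly GS fS c v"
      using v named_p[of v] named_colors_fS_G[of c v]
      by (simp add: guesses_correctly_def named_colors_def[of GS] fS_def p_def proj_def)
    then show ?thesis
      using v sub by blast
  next
    case True
    then have ex: "\<exists>v\<in>S. guesses_correctly G f p v"
      using v by blast
    \<comment> \<open>The vertex on which all observers of \<open>S\<close> agree; it may differ
      from \<open>v\<close>.\<close>
    define u where "u = alg (restrict p S)"
    define A where "A = named_colors G f (proj c) u"
    have u: "u \<in> S" "guesses_correctly G f p u"
      using alg[OF p ex] by (auto simp: u_def)
    then have uG: "u \<in> pverts G"
      using S by auto
    have cu: "c u div b u \<in> A"
      using u uG named_p[of u] by (simp add: guesses_correctly_def A_def p_def proj_def)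
    have cu_less: "c u < h u * b u"
      using c_less[of u] uG sub u by (auto simp: hS_def)
    have "c w < hS w" if "w \<in> neighborhood G u" for w
      using c_less sub neighborhood_subset(1) that by blast
    then have A: "A \<subseteq> {..<h u}" "card A \<le> s u * a u"
      using named_colors_G[OF uG, of c] g_eq[OF u(1)] by (auto simp: A_def)
    \<comment> \<open>Positivity of \<open>s u\<close> and \<open>b u\<close> gives
      \<open>h' z \<noteq> 0\<close>, so the guard in \<open>fS\<close> does not apply.\<close>
    have "s u \<noteq> 0"
    proof
      assume "s u = 0"
      then have "A = {}"
        using A finite_subset[OF A(1)] by simp
      then show False
        using cu by simp
    qed
    moreover have "b u \<noteq> 0"
      using cu_less by (auto intro: ccontr)
    ultimately have h'z: "h' z \<noteq> 0"
      using h'_eq[OF u(1)] by simp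
    \<comment> \<open>For \<open>s u = 1\<close> the merged color ignores the set of named colors,
      so \<open>names\<close> may be wrong; otherwise \<open>names\<close> returns
      \<open>A\<close>.\<close>
    have zc: "z_color c = merged_color (s u) (b u) A (c u)"
    proof (cases "s u = 1")
      case True
      then show ?thesis
        using u by (simp add: z_color_def Let_def flip: p_S u_def)
    next
      case False
      then show ?thesis
        using u names[OF p ex] by (simp add: z_color_def Let_def A_def named_p flip: p_S u_def)
    qed
    \<comment> \<open>The name \<open>z\<close> may also belong to \<open>G\<close>; for the game on
      \<open>G'\<close> its hat is replaced by the virtual color.\<close>
    define d where "d = restrict (c(z := z_color c)) (pverts G')"
    have "(c(z := z_color c)) w < h' w" if "w \<in> pverts G'" for w
      using c_less[of w] sub(2) hS_outside[OF that] z_color_less[OF h'z] that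
      by (cases "w = z") auto
    then have d: "d \<in> colorings (pverts G') h'"
      unfolding d_def by (intro restrict_in_colorings)
    have named_d: "named_colors G' f' d w = named_colors G' f' (c(z := z_color c)) w" for w
      using neighborhood_subset(2) by (intro named_colors_restrict) (auto simp: d_def)
    obtain w where w: "w \<in> pverts G'" "guesses_correctly G' f' d w"
      using f' d by (auto simp: winning_strategy_def)
    show ?thesis
    proof (cases "w = z")
      case False
      then have "w \<notin> pverts G" "w \<notin> S"
        using w disj S by auto
      then have "guesses_correctly GS fS c w"
        using w named_d[of w] named_colors_fS_G'[OF False, of c] False h'z
        by (simp add: guesses_correctly_def named_colors_def[of GS] fS_def d_def)
      then show ?thesis
        using w False sub by blast
    next
      case True
      \<comment> \<open>\<open>z\<close> is not its own neighbor, so its guess is independent of the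
        virtual color, and \<open>u\<close> sees every neighbor of \<open>z\<close>.\<close>
      have "named_colors G' f' d z = named_colors G' f' (restrict c (neighborhood GS u)) z"
        unfolding named_d using neighborhood_GS(2)[OF u(1)] z_notin_neighborhood
        by (intro named_colors_restrict) auto
      then have "merged_color (s u) (b u) A (c u)
          \<in> named_colors G' f' (restrict c (neighborhood GS u)) z"
        using w True zc by (simp add: guesses_correctly_def d_def)
      then have "guesses_correctly GS fS c u"
        using u cu cu_less named_colors_fS_G[of c u]
        by (simp add: guesses_correctly_def named_colors_def[of GS] fS_def Let_def A_def)
      then show ?thesis
        using uG sub by blast
    qed
  qed
qed

lemma winning_game_GS: "winning_game GS hS gS"
  using is_strategy_fS fS_wins by (auto simp: winning_game_def winning_strategy_def)

end

section \<open>Specialization to a predictable pair\<close>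

theorem theorem2p4:
  fixes G G' :: "'a pair_pre_digraph"
    and h g h' g' :: "'a \<Rightarrow> nat"
    and z :: 'a
    and S I :: "'a set"
    and s a b' :: "'a \<Rightarrow> nat"
  assumes "pair_graph G" and "pair_graph G'"
    and "z \<in> pverts G'"
    and "pverts G \<inter> (pverts G' - {z}) = {}"
    and "winning_game G h g" and "winning_game G' h' g'"
    and "I \<subseteq> S" and "S \<subseteq> pverts G"
    and "\<exists>f. winning_strategy G h g f \<and> predictable G h f S I"
    and "\<And>v. v \<in> I \<Longrightarrow> g v = s v * a v"
    and "\<And>v. v \<in> I \<Longrightarrow> h' z = s v * b' v"
  shows "winning_game (substitute_vertex G S G' z)
    (\<lambda>u. if u \<in> I then h u * b' u
         else if u \<in> S then h u * h' z
         else if u \<in> pverts G then h u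
         else h' u)
    (\<lambda>u. if u \<in> I then a u * g' z
         else if u \<in> S then g u * g' z
         else if u \<in> pverts G then g u
         else g' u)"
proof -
  obtain f alg names where f: "winning_strategy G h g f"
    and pred: "\<And>c. c \<in> colorings (pverts G) h \<Longrightarrow> \<exists>v\<in>S. guesses_correctly G f c v \<Longrightarrow>
      alg (restrict c S) \<in> S \<and> guesses_correctly G f c (alg (restrict c S)) \<and>
      (alg (restrict c S) \<in> I \<longrightarrow> names (restrict c S) = named_colors G f c (alg (restrict c S)))"
    using assms(9) unfolding predictable_def Let_def by metis
  obtain f' where f': "winning_strategy G' h' g' f'"
    using assms(6) by (auto simp: winning_game_def)
  \<comment> \<open>Off \<open>I\<close> the factorizations are \<open>g v = 1 * g v\<close> and
    \<open>h' z = 1 * h' z\<close>; hence \<open>s v \<noteq> 1\<close> forces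
    \<open>v \<in> I\<close>, where predictability supplies the named colors.\<close>
  interpret vertex_substitution G G' h g h' g' z S
    "\<lambda>v. if v \<in> I then s v else 1" "\<lambda>v. if v \<in> I then a v else g v"
    "\<lambda>v. if v \<in> I then b' v else h' z" f f' alg names
    by (rule vertex_substitution.intro)
      (use assms(1-4,7,8,10,11) f f' pred in \<open>auto split: if_splits\<close>)
  have "(\<lambda>u. if u \<in> I then h u * b' u else if u \<in> S then h u * h' z
      else if u \<in> pverts G then h u else h' u) = hS"
    and "(\<lambda>u. if u \<in> I then a u * g' z else if u \<in> S then g u * g' z
      else if u \<in> pverts G then g u else g' u) = gS"
    using \<open>I \<subseteq> S\<close> by (auto simp: hS_def gS_def fun_eq_iff)
  then show ?thesis
    using winning_game_GS by simp
qed

end
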